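(* Consider the relaxation solver (defined in the context) with initial data at equilibrium. Let $\beta\ge1$ and let $a_q^L,a_q^R>0$ be some quantities depending on $\omega^L,\omega^R$. Put, with $y_+=\max(y,0)$, $$X^L=\frac1{c^L}\left[M(v^L-v^R)_++\frac{\big(\pi^R-\pi^L+\bar\rho(W^L,W^R)(Z^R-Z^L)\big)_+}{\rho^La_q^L+\rho^Ra_q^R}\right],$$ $$X^R=\frac1{c^R}\left[M(v^L-v^R)_++\frac{\big(\pi^L-\pi^R+\bar\rho(W^L,W^R)(Z^L-Z^R)\big)_+}{\rho^La_q^L+\rho^Ra_q^R}\right],$$ where $c^L,c^R$ are the sound speeds. Assume that the relaxation speeds $a^L,a^R,b^L,b^R$ satisfy $$a^L\ge b^L,\quad a^R\ge b^R,\qquad \frac{b^L}{\rho^L}\ge a_q^L,\quad\frac{b^R}{\rho^R}\ge a_q^R,$$ $$\frac{\sqrt{a^Lb^L}}{\rho^L}\ge c^L(1+\beta X^L),\qquad \frac{\sqrt{a^Rb^R}}{\rho^R}\ge c^R(1+\beta X^R).$$ Then the approximate Riemann solver $W_{\mathcal R}$ preserves the positivity of the density, i.e. $\rho^{L*}>0$ and $\rho^{R*}>0$.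
   Context: $\omega^L,\omega^R\in\Omega=\{\omega=(\rho,\rho u,E):\rho>0,e>0\}$ with $E=\rho e+\frac12M^2\rho u^2$, $M>0$ the Mach number, $\tau=1/\rho$, pressure law $p=p(\tau,e)$, and sound speed $c>0$ given by $\rho^2c^2=p\,\partial_ep-\partial_\tau p$. Initial data at equilibrium means $\pi^\alpha=p(\tau^\alpha,e^\alpha)$, $v^\alpha=u^\alpha$, $Z^\alpha=\Phi^\alpha$ for $\alpha\in\{L,R\}$, where $\Phi^L,\Phi^R$ are given gravitational potential values. A state is $W=(\rho,\rho u,E,\rho\pi,\rho v,\rho Z,a,b)$; relaxation speeds are positive; $\bar\rho(W^L,W^R)$ is a density average with $\bar\rho=\rho$ if $\rho^L=\rho^R=\rho$. The approximate Riemann solver $W_{\mathcal R}(x/t;W^L,W^R)$ takes the values $W^L,W^{L*},W^{R*},W^R$ in the regions separated by the speeds $v^L-\frac{a^L}{M\rho^L}$, $v^*$, $v^R+\frac{a^R}{M\rho^R}$; its intermediate densities are $\frac1{\rho^{L*}}=\frac1{\rho^L}+\frac{Mb^R(v^R-v^L)+\pi^L-\pi^R-\bar\rho(W^L,W^R)(Z^R-Z^L)}{a^L(b^L+b^R)}$ and $\frac1{\rho^{R*}}=\frac1{\rho^R}+\frac{Mb^L(v^R-v^L)+\pi^R-\pi^L+\bar\rho(W^L,W^R)(Z^R-Z^L)}{a^R(b^L+b^R)}$. *)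

theory Defs
  imports "HOL-Analysis.Analysis"
begin

record fluid =
  dens :: real    (* rho *)
  mom :: real     (* rho u *)
  energy :: real  (* E *)

record relax_state = fluid +
  rpi :: real     (* rho pi *)
  rvel :: real    (* rho v *)
  rpot :: real    (* rho Z *)
  rel_a :: real
  rel_b :: real

definition velocity :: "'z fluid_scheme \<Rightarrow> real" where
  "velocity W = mom W / dens W"

(* The specific internal energy e, i.e. E = rho e + M^2 rho u^2 / 2 solved for e. *)
definition int_energy :: "real \<Rightarrow> 'z fluid_scheme \<Rightarrow> real" where
  "int_energy M W = (energy W - M\<^sup>2 * dens W * (velocity W)\<^sup>2 / 2) / dens W"

definition spec_vol :: "'z fluid_scheme \<Rightarrow> real" where
  "spec_vol W = 1 / dens W"

definition phase_space :: "real \<Rightarrow> fluid set" where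
  "phase_space M = {\<omega>. dens \<omega> > 0 \<and> int_energy M \<omega> > 0}"

definition relax_pi :: "relax_state \<Rightarrow> real" where
  "relax_pi W = rpi W / dens W"

definition relax_v :: "relax_state \<Rightarrow> real" where
  "relax_v W = rvel W / dens W"

definition relax_Z :: "relax_state \<Rightarrow> real" where
  "relax_Z W = rpot W / dens W"

(* p and c are functions of (tau, e), and rho = 1/tau. *)
definition is_sound_speed :: "(real \<Rightarrow> real \<Rightarrow> real) \<Rightarrow> (real \<Rightarrow> real \<Rightarrow> real) \<Rightarrow> bool" where
  "is_sound_speed p c \<longleftrightarrow> (\<forall>\<tau>>0. \<forall>e>0.
     (\<lambda>t. p t e) differentiable at \<tau> \<and> (\<lambda>s. p \<tau> s) differentiable at e \<and>
     c \<tau> e > 0 \<and>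
     (1 / \<tau>)\<^sup>2 * (c \<tau> e)\<^sup>2 = p \<tau> e * deriv (\<lambda>s. p \<tau> s) e - deriv (\<lambda>t. p t e) \<tau>)"

definition at_equilibrium ::
    "real \<Rightarrow> (real \<Rightarrow> real \<Rightarrow> real) \<Rightarrow> real \<Rightarrow> relax_state \<Rightarrow> bool" where
  "at_equilibrium M p \<Phi> W \<longleftrightarrow>
     relax_pi W = p (spec_vol W) (int_energy M W) \<and> relax_v W = velocity W \<and> relax_Z W = \<Phi>"

definition density_average :: "(relax_state \<Rightarrow> relax_state \<Rightarrow> real) \<Rightarrow> bool" where
  "density_average rhobar \<longleftrightarrow>
     (\<forall>WL WR. dens WL > 0 \<and> dens WL = dens WR \<longrightarrow> rhobar WL WR = dens WL)"

definition solver_admissible :: "relax_state \<Rightarrow> bool" where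
  "solver_admissible W \<longleftrightarrow> dens W > 0 \<and> rel_a W > 0 \<and> rel_b W > 0"

(* S \<xi> WL WR is the value of the solver at \<xi> = x/t. No ordering of the three speeds is built in:
   for the solver's contact speed it would already amount to positive intermediate densities.
   The middle speed and the components of the intermediate states other than the densities are
   left unconstrained. On an interface the value is the one from the right. *)
definition is_relaxation_solver ::
    "real \<Rightarrow> (relax_state \<Rightarrow> relax_state \<Rightarrow> real) \<Rightarrow> (relax_state \<Rightarrow> relax_state \<Rightarrow> real) \<Rightarrow>
     (relax_state \<Rightarrow> relax_state \<Rightarrow> relax_state) \<Rightarrow> (relax_state \<Rightarrow> relax_state \<Rightarrow> relax_state) \<Rightarrow>
     (real \<Rightarrow> relax_state \<Rightarrow> relax_state \<Rightarrow> relax_state) \<Rightarrow> bool" where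
  "is_relaxation_solver M rhobar vstar WLstar WRstar S \<longleftrightarrow>
    (\<forall>WL WR. solver_admissible WL \<and> solver_admissible WR \<longrightarrow>
      (\<forall>\<xi>. S \<xi> WL WR =
         (if \<xi> < relax_v WL - rel_a WL / (M * dens WL) then WL
          else if \<xi> < vstar WL WR then WLstar WL WR
          else if \<xi> < relax_v WR + rel_a WR / (M * dens WR) then WRstar WL WR
          else WR)) \<and>
      1 / dens (WLstar WL WR) = 1 / dens WL +
        (M * rel_b WR * (relax_v WR - relax_v WL) + relax_pi WL - relax_pi WR
           - rhobar WL WR * (relax_Z WR - relax_Z WL)) / (rel_a WL * (rel_b WL + rel_b WR)) \<and>
      1 / dens (WRstar WL WR) = 1 / dens WR +
        (M * rel_b WL * (relax_v WR - relax_v WL) + relax_pi WR - relax_pi WL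
           + rhobar WL WR * (relax_Z WR - relax_Z WL)) / (rel_a WR * (rel_b WL + rel_b WR)))"

end

theory Submission
  imports Defs
begin

text \<open>The drop of the specific volume across an outer wave is at most \<open>c X / a\<close>: the velocity
  jump enters with the weight \<open>b' / (b + b') \<le> 1\<close>, and the pressure jump is divided by
  \<open>b + b'\<close>, which is at least \<open>\<rho>\<^sup>L a\<^sub>q\<^sup>L + \<rho>\<^sup>R a\<^sub>q\<^sup>R\<close>. Since \<open>a / \<rho> \<ge> sqrt (a b) / \<rho> \<ge> c (1 + \<beta> X) > c X\<close>,
  the drop is smaller than \<open>1 / \<rho>\<close>.\<close>

lemma intermediate_spec_vol_pos:
  fixes M \<rho> c a b b' D \<beta> X w q N :: real
  assumes "M > 0" "\<rho> > 0" "c > 0" "b > 0" "b' > 0" "b \<le> a" "D > 0" "D \<le> b + b'" "\<beta> \<ge> 1"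
    and X: "X = 1 / c * (M * max w 0 + max q 0 / D)"
    and speed: "sqrt (a * b) / \<rho> \<ge> c * (1 + \<beta> * X)"
    and N: "N = - (M * b' * w + q)"
  shows "1 / \<rho> + N / (a * (b + b')) > 0"
proof -
  have "a > 0" using assms by linarith
  have "X \<ge> 0" using assms by (simp add: X)
  have cX: "c * X = M * max w 0 + max q 0 / D" using \<open>c > 0\<close> by (simp add: X)
  \<comment> \<open>Strictness comes from the summand 1, since \<open>X\<close> is nonnegative and
    hence at most \<open>\<beta> * X\<close>.\<close>
  have "c * X < c * (1 + \<beta> * X)"
    using \<open>c > 0\<close> mult_right_mono[OF \<open>\<beta> \<ge> 1\<close> \<open>X \<ge> 0\<close>] by simp
  also have "\<dots> \<le> sqrt (a * b) / \<rho>" by (rule speed)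
  also have "\<dots> \<le> a / \<rho>"
    using \<open>a > 0\<close> \<open>b > 0\<close> \<open>b \<le> a\<close> \<open>\<rho> > 0\<close>
    by (intro divide_right_mono real_le_lsqrt) (auto simp: power2_eq_square)
  finally have "c * X / a < 1 / \<rho>"
    using \<open>a > 0\<close> \<open>\<rho> > 0\<close> by (simp add: field_simps)
  moreover have "- N / (a * (b + b')) \<le> c * X / a"
  proof -
    \<comment> \<open>Only a compressive jump \<open>w > 0\<close> can lower the specific volume.
      Passing to the positive part first makes enlarging \<open>b'\<close> to \<open>b + b'\<close>
      monotone.\<close>
    have "M * b' * w \<le> (b + b') * (M * max w 0)"
    proof -
      have "M * b' * w \<le> M * b' * max w 0" using assms by (intro mult_left_mono) auto
      also have "\<dots> \<le> M * (b + b') * max w 0"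
        using assms by (intro mult_right_mono mult_left_mono) auto
      finally show ?thesis by (simp add: algebra_simps)
    qed
    moreover have "q \<le> (b + b') * (max q 0 / D)"
    proof -
      have "q \<le> D * (max q 0 / D)" using \<open>D > 0\<close> by simp
      also have "\<dots> \<le> (b + b') * (max q 0 / D)"
        using \<open>D > 0\<close> \<open>D \<le> b + b'\<close> by (intro mult_right_mono) auto
      finally show ?thesis .
    qed
    ultimately have "- N \<le> (b + b') * (c * X)"
      unfolding N cX distrib_left by linarith
    then have "- N / (a * (b + b')) \<le> (b + b') * (c * X) / (a * (b + b'))"
      using \<open>a > 0\<close> \<open>b > 0\<close> \<open>b' > 0\<close> by (intro divide_right_mono) auto
    then show ?thesis using \<open>b > 0\<close> \<open>b' > 0\<close> by simp
  qed
  ultimately show ?thesis by simp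
qed

text \<open>The phase space consists of plain \<open>fluid\<close> records. Truncation keeps the
  three fields that \<open>dens\<close> and \<open>int_energy\<close> read, so both conditions carry
  over to the relaxation state.\<close>

lemma truncate_phase_space_iff:
  "fluid.truncate W \<in> phase_space M \<longleftrightarrow> dens W > 0 \<and> int_energy M W > 0"
  by (simp add: phase_space_def int_energy_def velocity_def fluid.truncate_def)

lemma sound_speed_pos:
  "is_sound_speed p c \<Longrightarrow> dens W > 0 \<Longrightarrow> int_energy M W > 0 \<Longrightarrow>
    c (spec_vol W) (int_energy M W) > 0"
  by (simp add: is_sound_speed_def spec_vol_def)

theorem lemma7:
  fixes M \<beta> \<Phi>L \<Phi>R cL cR XL XR :: real
    and p c :: "real \<Rightarrow> real \<Rightarrow> real"
    and WL WR :: relax_state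
    and \<omega>L \<omega>R :: fluid
    and aqL aqR :: "fluid \<Rightarrow> fluid \<Rightarrow> real"
    and rhobar vstar :: "relax_state \<Rightarrow> relax_state \<Rightarrow> real"
    and WLstar WRstar :: "relax_state \<Rightarrow> relax_state \<Rightarrow> relax_state"
    and S :: "real \<Rightarrow> relax_state \<Rightarrow> relax_state \<Rightarrow> relax_state"
  assumes "M > 0"
    and "is_sound_speed p c"
    and "density_average rhobar"
    and "is_relaxation_solver M rhobar vstar WLstar WRstar S"
    and "\<omega>L = fluid.truncate WL" and "\<omega>R = fluid.truncate WR"
    and "\<omega>L \<in> phase_space M" and "\<omega>R \<in> phase_space M"
    and "at_equilibrium M p \<Phi>L WL" and "at_equilibrium M p \<Phi>R WR"
    and "cL = c (spec_vol WL) (int_energy M WL)" and "cR = c (spec_vol WR) (int_energy M WR)"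
    and "rel_a WL > 0" and "rel_a WR > 0" and "rel_b WL > 0" and "rel_b WR > 0"
    and "\<beta> \<ge> 1"
    and "aqL \<omega>L \<omega>R > 0" and "aqR \<omega>L \<omega>R > 0"
    and "XL = 1 / cL * (M * max (relax_v WL - relax_v WR) 0
           + max (relax_pi WR - relax_pi WL + rhobar WL WR * (relax_Z WR - relax_Z WL)) 0
             / (dens WL * aqL \<omega>L \<omega>R + dens WR * aqR \<omega>L \<omega>R))"
    and "XR = 1 / cR * (M * max (relax_v WL - relax_v WR) 0
           + max (relax_pi WL - relax_pi WR + rhobar WL WR * (relax_Z WL - relax_Z WR)) 0
             / (dens WL * aqL \<omega>L \<omega>R + dens WR * aqR \<omega>L \<omega>R))"
    and "rel_a WL \<ge> rel_b WL" and "rel_a WR \<ge> rel_b WR"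
    and "rel_b WL / dens WL \<ge> aqL \<omega>L \<omega>R" and "rel_b WR / dens WR \<ge> aqR \<omega>L \<omega>R"
    and "sqrt (rel_a WL * rel_b WL) / dens WL \<ge> cL * (1 + \<beta> * XL)"
    and "sqrt (rel_a WR * rel_b WR) / dens WR \<ge> cR * (1 + \<beta> * XR)"
  shows "dens (WLstar WL WR) > 0 \<and> dens (WRstar WL WR) > 0 \<and> (\<forall>\<xi>. dens (S \<xi> WL WR) > 0)"
proof -
  have L: "dens WL > 0" "int_energy M WL > 0" and R: "dens WR > 0" "int_energy M WR > 0"
    using assms(5-8) by (simp_all add: truncate_phase_space_iff)
  have cL: "cL > 0" and cR: "cR > 0"
    using assms(2,11,12) L R by (simp_all add: sound_speed_pos)
  have adm: "solver_admissible WL" "solver_admissible WR"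
    using assms(13-16) L R by (simp_all add: solver_admissible_def)
  define D where "D = dens WL * aqL \<omega>L \<omega>R + dens WR * aqR \<omega>L \<omega>R"
  \<comment> \<open>Clearing the densities in \<open>b / \<rho> \<ge> a_q\<close> on each side and
    adding gives the upper bound. Both orders of the sum are kept because the right wave swaps the
    roles of the two \<open>b\<close>.\<close>
  have D: "D > 0" "D \<le> rel_b WL + rel_b WR" "D \<le> rel_b WR + rel_b WL"
    using assms(18,19,24,25) L R by (auto simp: D_def field_simps intro!: add_pos_pos add_mono)
  note solver = assms(4)[unfolded is_relaxation_solver_def, THEN spec, THEN spec, THEN mp, OF conjI[OF adm]]
  have "1 / dens (WLstar WL WR) > 0"
    unfolding solver[THEN conjunct2, THEN conjunct1]
    by (rule intermediate_spec_vol_pos[OF assms(1) L(1) cL assms(15,16,22) D(1,2) assms(17)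
          assms(20)[folded D_def] assms(26)]) (simp add: algebra_simps)
  \<comment> \<open>As \<open>1 / 0 = 0\<close>, a positive reciprocal also rules out density
    zero.\<close>
  then have Lstar: "dens (WLstar WL WR) > 0" by simp
  \<comment> \<open>Mirror image of the left wave: \<open>w\<close> is again the left velocity minus
    the right one, while \<open>q\<close> changes sign and \<open>b\<close>, \<open>b'\<close> are
    exchanged.\<close>
  have "1 / dens (WRstar WL WR) > 0"
    unfolding solver[THEN conjunct2, THEN conjunct2] add.commute[of "rel_b WL"]
    by (rule intermediate_spec_vol_pos[OF assms(1) R(1) cR assms(16,15,23) D(1,3) assms(17)
          assms(21)[folded D_def] assms(27)]) (simp add: algebra_simps)
  then have Rstar: "dens (WRstar WL WR) > 0" by simp
  \<comment> \<open>Whatever the order of the speeds, every branch of the solver returns one of the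
    four states now known to have positive density.\<close>
  show ?thesis
    using solver[THEN conjunct1] Lstar Rstar L R by simp
qed

end
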